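(* Let $\mathrm{Var}$ be a denumerable set of propositional variables, let $\Gamma$ be a set of monoidal functional dependencies over $\mathrm{Var}$, and let $A \Rightarrow B$ be a monoidal functional dependency over $\mathrm{Var}$. Then $\Gamma \vdash A \Rightarrow B$ if and only if, for every complete residuated lattice $\mathbf{L}$, $A \Rightarrow B$ is satisfied by each $\mathbf{L}$-model of $\Gamma$.
   Context: Let $\mathrm{Var}$ be a fixed denumerable set (propositional variables). A finite multiset over $\mathrm{Var}$ is a map $A\colon \mathrm{Var} \to \mathbb{Z}$ with $A(p) \ge 0$ for all $p$ and $\{p : A(p) > 0\}$ finite. $AB$ denotes the multiset $(AB)(p) = A(p)+B(p)$. A monoidal functional dependency (MFD) is an expression $A \Rightarrow B$ with $A,B$ finite multisets over $\mathrm{Var}$. Provability: the inference rules are, for arbitrary finite multisets $A,B,C,D$: (Ax) infer $AB \Rightarrow B$ (from no premises); (Cut) from $A \Rightarrow B$ and $BC \Rightarrow D$ infer $AC \Rightarrow D$. A proof of $\varphi_n$ by $\Gamma$ is a finite sequence $\varphi_1,\dots,\varphi_n$ of MFDs in which each $\varphi_i$ is in $\Gamma$ or is derived from $\varphi_1,\dots,\varphi_{i-1}$ by (Ax) or (Cut). $\Gamma \vdash A \Rightarrow B$ means there is a proof of $A \Rightarrow B$ by $\Gamma$. An integral commutative pomonoid is $\langle L,\le,\otimes,1\rangle$ where $\langle L,\otimes,1\rangle$ is a commutative monoid, $\le$ is a partial order on $L$, $\otimes$ is monotone with respect to $\le$, and $1$ is the greatest element. A residuated lattice (here: integral, commutative,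 bounded) is $\mathbf{L} = \langle L,\wedge,\vee,\otimes,\rightarrow,0,1\rangle$ where $\langle L,\wedge,\vee,0,1\rangle$ is a bounded lattice with order $\le$, $\langle L,\le,\otimes,1\rangle$ is an integral commutative pomonoid, and $a\otimes b \le c$ iff $a \le b \rightarrow c$ for all $a,b,c\in L$. It is complete if its lattice is a complete lattice. Powers: $a^0=1$, $a^{n+1}=a\otimes a^n$. An $\mathbf{L}$-evaluation is a map $e\colon \mathrm{Var}\to L$, extended to multisets by $e(A) = e(p_1)^{A(p_1)} \otimes\cdots\otimes e(p_n)^{A(p_n)}$ where $\{p : A(p)>0\} \subseteq \{p_1,\dots,p_n\}$ ($p_i$ distinct). $A\Rightarrow B$ is satisfied by $e$ if $e(A)\le e(B)$; $e$ is an $\mathbf{L}$-model of $\Gamma$ if it satisfies every MFD in $\Gamma$. *)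

theory Defs
  imports
    "HOL-Library.Multiset"
    "HOL-Library.Countable"
    "HOL-Library.Infinite_Typeclass"
    "HOL-Algebra.Complete_Lattice"
    "HOL-Algebra.FiniteProduct"
begin

section \<open>Monoidal functional dependencies and provability\<close>

text \<open>The multiset written \<open>AB\<close> by juxtaposition is the multiset sum \<open>A + B\<close>.\<close>

datatype 'v mfd = MFD "'v multiset" "'v multiset"  (infix \<open>\<Rrightarrow>\<close> 55)

definition by_Ax :: "'v mfd \<Rightarrow> bool" where
  "by_Ax \<phi> \<longleftrightarrow> (\<exists>A B. \<phi> = (A + B \<Rrightarrow> B))"

definition by_Cut :: "'v mfd \<Rightarrow> 'v mfd \<Rightarrow> 'v mfd \<Rightarrow> bool" where
  "by_Cut \<psi> \<chi> \<phi> \<longleftrightarrow>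
     (\<exists>A B C D. \<psi> = (A \<Rrightarrow> B) \<and> \<chi> = (B + C \<Rrightarrow> D) \<and> \<phi> = (A + C \<Rrightarrow> D))"

definition is_proof :: "'v mfd set \<Rightarrow> 'v mfd list \<Rightarrow> bool" where
  "is_proof \<Gamma> \<phi>s \<longleftrightarrow>
     (\<forall>i < length \<phi>s. \<phi>s ! i \<in> \<Gamma> \<or> by_Ax (\<phi>s ! i) \<or>
        (\<exists>j < i. \<exists>k < i. by_Cut (\<phi>s ! j) (\<phi>s ! k) (\<phi>s ! i)))"

definition provable :: "'v mfd set \<Rightarrow> 'v mfd \<Rightarrow> bool"  (infix \<open>\<turnstile>\<close> 50) where
  "\<Gamma> \<turnstile> \<phi> \<longleftrightarrow> (\<exists>\<phi>s. \<phi>s \<noteq> [] \<and> is_proof \<Gamma> \<phi>s \<and> last \<phi>s = \<phi>)"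


section \<open>Residuated lattices\<close>

text \<open>
  The carrier, the multiplication and the unit are inherited from \<open>monoid\<close>;
  the unit is at the same time the top element of the lattice.
\<close>

record 'a reslat = "'a monoid" +
  rmeet :: "'a \<Rightarrow> 'a \<Rightarrow> 'a"
  rjoin :: "'a \<Rightarrow> 'a \<Rightarrow> 'a"
  rimp  :: "'a \<Rightarrow> 'a \<Rightarrow> 'a"
  rzero :: 'a

text \<open>The lattice order, given by \<open>a \<le> b\<close> iff \<open>a \<and> b = a\<close>.\<close>

definition rorder :: "('a, 'm) reslat_scheme \<Rightarrow> 'a gorder" where
  "rorder L = \<lparr>carrier = carrier L, eq = (=), le = (\<lambda>a b. rmeet L a b = a)\<rparr>"

abbreviation rle :: "('a, 'm) reslat_scheme \<Rightarrow> 'a \<Rightarrow> 'a \<Rightarrow> bool" where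
  "rle L a b \<equiv> a \<sqsubseteq>\<^bsub>rorder L\<^esub> b"

locale residuated_lattice = comm_monoid L for L (structure) +
  assumes lattice: "lattice (rorder L)"
    and meet: "\<lbrakk>a \<in> carrier L; b \<in> carrier L\<rbrakk> \<Longrightarrow>
      greatest (rorder L) (rmeet L a b) (Lower (rorder L) {a, b})"
    and join: "\<lbrakk>a \<in> carrier L; b \<in> carrier L\<rbrakk> \<Longrightarrow>
      least (rorder L) (rjoin L a b) (Upper (rorder L) {a, b})"
    and zero_least: "least (rorder L) (rzero L) (carrier L)"
    and one_greatest: "greatest (rorder L) \<one> (carrier L)"
    and mult_mono: "\<lbrakk>a \<in> carrier L; b \<in> carrier L; c \<in> carrier L; d \<in> carrier L;
      rle L a b; rle L c d\<rbrakk> \<Longrightarrow> rle L (a \<otimes> c) (b \<otimes> d)"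
    and imp_closed: "\<lbrakk>a \<in> carrier L; b \<in> carrier L\<rbrakk> \<Longrightarrow> rimp L a b \<in> carrier L"
    and adjoint: "\<lbrakk>a \<in> carrier L; b \<in> carrier L; c \<in> carrier L\<rbrakk> \<Longrightarrow>
      rle L (a \<otimes> b) c \<longleftrightarrow> rle L a (rimp L b c)"

locale complete_residuated_lattice = residuated_lattice +
  assumes complete: "complete_lattice (rorder L)"


section \<open>Evaluations and models\<close>

definition evaluation :: "('a, 'm) reslat_scheme \<Rightarrow> ('v \<Rightarrow> 'a) \<Rightarrow> bool" where
  "evaluation L e \<longleftrightarrow> range e \<subseteq> carrier L"

definition eval_mset :: "('a, 'm) reslat_scheme \<Rightarrow> ('v \<Rightarrow> 'a) \<Rightarrow> 'v multiset \<Rightarrow> 'a" where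
  "eval_mset L e A = (\<Otimes>\<^bsub>L\<^esub>p \<in> set_mset A. e p [^]\<^bsub>L\<^esub> count A p)"

fun satisfies :: "('a, 'm) reslat_scheme \<Rightarrow> ('v \<Rightarrow> 'a) \<Rightarrow> 'v mfd \<Rightarrow> bool" where
  "satisfies L e (A \<Rrightarrow> B) \<longleftrightarrow> rle L (eval_mset L e A) (eval_mset L e B)"

definition is_model :: "('a, 'm) reslat_scheme \<Rightarrow> ('v \<Rightarrow> 'a) \<Rightarrow> 'v mfd set \<Rightarrow> bool" where
  "is_model L e \<Gamma> \<longleftrightarrow> evaluation L e \<and> (\<forall>\<phi>\<in>\<Gamma>. satisfies L e \<phi>)"

text \<open>
  A HOL formula cannot quantify over the residuated lattices of all types at once.
  Semantic consequence is therefore stated relative to the type of which the carriers are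
  subsets, passed as a type argument. Consequence over every complete residuated lattice is
  obtained by leaving that type arbitrary, but an arbitrary type may be too small to contain
  a countermodel; the type of sets of multisets of variables is large enough.
\<close>

definition entails_over :: "'a itself \<Rightarrow> 'v mfd set \<Rightarrow> 'v mfd \<Rightarrow> bool" where
  "entails_over (T :: 'a itself) \<Gamma> \<phi> \<longleftrightarrow>
     (\<forall>L :: 'a reslat. complete_residuated_lattice L \<longrightarrow>
        (\<forall>e. is_model L e \<Gamma> \<longrightarrow> satisfies L e \<phi>))"

end

theory Submission
  imports Defs
begin

text \<open>
  Soundness is by induction along the proof. For completeness, provability preorders the finite
  multisets and is compatible with multiset sum; its down-sets, ordered by inclusion and
  multiplied elementwise, form a complete residuated lattice. Evaluating every variable \<open>p\<close> as
  the principal down-set of \<open>{#p#}\<close> evaluates every multiset as its principal down-set, so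
  satisfaction under this evaluation is exactly provability.
\<close>

section \<open>Admissible rules\<close>

lemma is_proof_Nil: "is_proof \<Gamma> []"
  by (simp add: is_proof_def)

text \<open>Replaces positions in the list by membership in a prefix, so that reverse list induction
  serves as induction along a proof.\<close>

lemma is_proof_snoc_iff:
  "is_proof \<Gamma> (\<phi>s @ [\<phi>]) \<longleftrightarrow> is_proof \<Gamma> \<phi>s \<and>
     (\<phi> \<in> \<Gamma> \<or> by_Ax \<phi> \<or> (\<exists>\<psi>\<in>set \<phi>s. \<exists>\<chi>\<in>set \<phi>s. by_Cut \<psi> \<chi> \<phi>))"
proof -
  define step where "step \<chi>s i \<longleftrightarrow> \<chi>s ! i \<in> \<Gamma> \<or> by_Ax (\<chi>s ! i) \<or>
    (\<exists>j<i. \<exists>k<i. by_Cut (\<chi>s ! j) (\<chi>s ! k) (\<chi>s ! i))" for \<chi>s i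
  have is_proof_iff: "is_proof \<Gamma> \<chi>s \<longleftrightarrow> (\<forall>i<length \<chi>s. step \<chi>s i)" for \<chi>s
    by (simp add: is_proof_def step_def)
  \<comment> \<open>A step refers only to positions at most its own, so a longer list does not
    affect it.\<close>
  have old: "step (\<phi>s @ [\<phi>]) i \<longleftrightarrow> step \<phi>s i" if "i < length \<phi>s" for i
    using that by (simp add: step_def nth_append cong: conj_cong)
  have "step (\<phi>s @ [\<phi>]) (length \<phi>s) \<longleftrightarrow>
      \<phi> \<in> \<Gamma> \<or> by_Ax \<phi> \<or> (\<exists>j<length \<phi>s. \<exists>k<length \<phi>s. by_Cut (\<phi>s ! j) (\<phi>s ! k) \<phi>)"
    by (simp add: step_def nth_append cong: conj_cong)
  also have "(\<exists>j<length \<phi>s. \<exists>k<length \<phi>s. by_Cut (\<phi>s ! j) (\<phi>s ! k) \<phi>) \<longleftrightarrow>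
      (\<exists>\<psi>\<in>set \<phi>s. \<exists>\<chi>\<in>set \<phi>s. by_Cut \<psi> \<chi> \<phi>)"
    by (simp add: set_conv_nth) blast
  finally show ?thesis
    by (simp add: is_proof_iff All_less_Suc old conj_commute cong: conj_cong)
qed

text \<open>Needed to put the proofs of both premises of a Cut into one sequence; steps of the
  second proof still find their premises earlier.\<close>

lemma is_proof_append:
  assumes "is_proof \<Gamma> \<phi>s" and "is_proof \<Gamma> \<psi>s"
  shows "is_proof \<Gamma> (\<phi>s @ \<psi>s)"
  using assms(2)
proof (induction \<psi>s rule: rev_induct)
  case Nil
  then show ?case using assms(1) by simp
next
  case (snoc \<phi> \<psi>s)
  then have "is_proof \<Gamma> ((\<phi>s @ \<psi>s) @ [\<phi>])"
    unfolding is_proof_snoc_iff set_append by blast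
  then show ?case by simp
qed

lemma provable_hyp: "\<phi> \<in> \<Gamma> \<Longrightarrow> \<Gamma> \<turnstile> \<phi>"
  unfolding provable_def
  by (intro exI[of _ "[\<phi>]"]) (simp add: is_proof_snoc_iff[of _ "[]", simplified] is_proof_Nil)

lemma provable_Ax: "\<Gamma> \<turnstile> (A + B \<Rrightarrow> B)"
  unfolding provable_def
  by (intro exI[of _ "[A + B \<Rrightarrow> B]"])
     (auto simp: is_proof_snoc_iff[of _ "[]", simplified] is_proof_Nil by_Ax_def)

lemma provable_Cut:
  assumes "\<Gamma> \<turnstile> (A \<Rrightarrow> B)" and "\<Gamma> \<turnstile> (B + C \<Rrightarrow> D)"
  shows "\<Gamma> \<turnstile> (A + C \<Rrightarrow> D)"
proof -
  obtain \<phi>s \<psi>s where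
    "\<phi>s \<noteq> []" "is_proof \<Gamma> \<phi>s" "last \<phi>s = (A \<Rrightarrow> B)"
    "\<psi>s \<noteq> []" "is_proof \<Gamma> \<psi>s" "last \<psi>s = (B + C \<Rrightarrow> D)"
    using assms unfolding provable_def by blast
  moreover from this have "(A \<Rrightarrow> B) \<in> set (\<phi>s @ \<psi>s)" "(B + C \<Rrightarrow> D) \<in> set (\<phi>s @ \<psi>s)"
    by (metis Un_iff last_in_set set_append)+
  moreover have "by_Cut (A \<Rrightarrow> B) (B + C \<Rrightarrow> D) (A + C \<Rrightarrow> D)"
    unfolding by_Cut_def by blast
  ultimately have "is_proof \<Gamma> ((\<phi>s @ \<psi>s) @ [A + C \<Rrightarrow> D])"
    unfolding is_proof_snoc_iff by (blast intro: is_proof_append)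
  then show ?thesis
    unfolding provable_def by (metis last_snoc snoc_eq_iff_butlast)
qed

lemma provable_refl: "\<Gamma> \<turnstile> (A \<Rrightarrow> A)"
  using provable_Ax[of \<Gamma> "{#}" A] by simp

lemma provable_trans:
  assumes "\<Gamma> \<turnstile> (A \<Rrightarrow> B)" and "\<Gamma> \<turnstile> (B \<Rrightarrow> C)"
  shows "\<Gamma> \<turnstile> (A \<Rrightarrow> C)"
  using provable_Cut[of \<Gamma> A B "{#}" C] assms by simp

text \<open>One Cut exchanges each summand, and transitivity joins the two. This compatibility with
  sum is what multiplication and residuation of down-sets rest on.\<close>

lemma provable_add:
  assumes "\<Gamma> \<turnstile> (A \<Rrightarrow> B)" and "\<Gamma> \<turnstile> (C \<Rrightarrow> D)"
  shows "\<Gamma> \<turnstile> (A + C \<Rrightarrow> B + D)"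
proof -
  have "\<Gamma> \<turnstile> (A + C \<Rrightarrow> B + C)"
    \<comment> \<open>The second premise of the Cut is the reflexive MFD on
      \<open>B + C\<close>.\<close>
    using assms(1) provable_refl by (rule provable_Cut)
  moreover have "\<Gamma> \<turnstile> (C + B \<Rrightarrow> D + B)"
    using assms(2) provable_refl by (rule provable_Cut)
  ultimately show ?thesis
    using provable_trans by (metis add.commute)
qed

section \<open>Soundness\<close>

context residuated_lattice
begin

text \<open>A variable outside \<open>A\<close> has exponent 0 and contributes the unit. Hence
  \<open>A\<close>, \<open>B\<close> and \<open>A + B\<close> can be evaluated over one common index
  set.\<close>

lemma eval_mset_superset:
  assumes "evaluation L e" and "finite U" and "set_mset A \<subseteq> U"
  shows "eval_mset L e A = (\<Otimes>p\<in>U. e p [^] count A p)"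
  unfolding eval_mset_def using assms
  by (intro finprod_mono_neutral_cong_left)
     (auto simp: evaluation_def image_subset_iff not_in_iff[THEN iffD1])

lemma eval_mset_closed:
  assumes "evaluation L e"
  shows "eval_mset L e A \<in> carrier L"
  unfolding eval_mset_def using assms
  by (intro finprod_closed) (auto simp: evaluation_def)

lemma eval_mset_empty: "eval_mset L e {#} = \<one>"
  by (simp add: eval_mset_def)

lemma eval_mset_single:
  assumes "evaluation L e"
  shows "eval_mset L e {#p#} = e p"
  using assms by (simp add: eval_mset_def evaluation_def image_subset_iff)

lemma eval_mset_union:
  assumes "evaluation L e"
  shows "eval_mset L e (A + B) = eval_mset L e A \<otimes> eval_mset L e B"
proof -
  let ?U = "set_mset A \<union> set_mset B"
  have e: "e p \<in> carrier L" for p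
    using assms by (auto simp: evaluation_def)
  have "eval_mset L e (A + B) = (\<Otimes>p\<in>?U. e p [^] count A p \<otimes> e p [^] count B p)"
    using assms by (simp add: eval_mset_superset[where U = ?U] e nat_pow_mult)
  also have "\<dots> = (\<Otimes>p\<in>?U. e p [^] count A p) \<otimes> (\<Otimes>p\<in>?U. e p [^] count B p)"
    by (rule finprod_multf) (auto simp: e)
  also have "\<dots> = eval_mset L e A \<otimes> eval_mset L e B"
    using assms by (simp add: eval_mset_superset[where U = ?U])
  finally show ?thesis .
qed

section \<open>The lattice order and validity of the inference rules\<close>

lemma rle_refl: "a \<in> carrier L \<Longrightarrow> rle L a a"
proof -
  interpret lattice "rorder L" by (rule lattice)
  show "a \<in> carrier L \<Longrightarrow> rle L a a"
    using le_refl by (simp add: rorder_def)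
qed

lemma rle_trans:
  assumes "rle L a b" "rle L b c" "a \<in> carrier L" "b \<in> carrier L" "c \<in> carrier L"
  shows "rle L a c"
proof -
  interpret lattice "rorder L" by (rule lattice)
  show ?thesis
    using le_trans[OF assms(1,2)] assms(3-5) by (simp add: rorder_def)
qed

lemma rle_one: "a \<in> carrier L \<Longrightarrow> rle L a \<one>"
  using one_greatest by (auto simp: greatest_def)

lemma satisfies_Ax:
  assumes "evaluation L e"
  shows "satisfies L e (A + B \<Rrightarrow> B)"
proof -
  note closed = eval_mset_closed[OF assms]
  \<comment> \<open>Integrality enters here: the factor for \<open>A\<close> lies below the
    unit.\<close>
  have "rle L (eval_mset L e A \<otimes> eval_mset L e B) (\<one> \<otimes> eval_mset L e B)"
    by (intro mult_mono rle_one rle_refl closed one_closed)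
  then show ?thesis
    by (simp add: eval_mset_union[OF assms] closed)
qed

lemma satisfies_Cut:
  assumes "evaluation L e" "satisfies L e (A \<Rrightarrow> B)" "satisfies L e (B + C \<Rrightarrow> D)"
  shows "satisfies L e (A + C \<Rrightarrow> D)"
proof -
  note closed = eval_mset_closed[OF assms(1)]
  have "rle L (eval_mset L e A \<otimes> eval_mset L e C) (eval_mset L e B \<otimes> eval_mset L e C)"
    using assms(2) by (intro mult_mono rle_refl closed) simp
  then show ?thesis
    using assms(3) by (auto simp: eval_mset_union[OF assms(1)] closed intro: rle_trans)
qed

lemma soundness:
  assumes "is_model L e \<Gamma>" and "\<Gamma> \<turnstile> \<phi>"
  shows "satisfies L e \<phi>"
proof -
  have e: "evaluation L e" and \<Gamma>: "\<And>\<psi>. \<psi> \<in> \<Gamma> \<Longrightarrow> satisfies L e \<psi>"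
    using assms(1) by (simp_all add: is_model_def)
  \<comment> \<open>The claim covers all entries, not just the last, because a Cut may use any
    earlier ones.\<close>
  have "\<forall>\<phi>\<in>set \<phi>s. satisfies L e \<phi>" if "is_proof \<Gamma> \<phi>s" for \<phi>s
    using that
  proof (induction \<phi>s rule: rev_induct)
    case Nil
    then show ?case by simp
  next
    case (snoc \<phi> \<phi>s)
    then have IH: "\<forall>\<psi>\<in>set \<phi>s. satisfies L e \<psi>"
      unfolding is_proof_snoc_iff by blast
    from snoc.prems consider "\<phi> \<in> \<Gamma>" | "by_Ax \<phi>"
      | \<psi> \<chi> where "\<psi> \<in> set \<phi>s" "\<chi> \<in> set \<phi>s" "by_Cut \<psi> \<chi> \<phi>"
      unfolding is_proof_snoc_iff by blast
    then have "satisfies L e \<phi>"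
    proof cases
      case 1
      then show ?thesis by (rule \<Gamma>)
    next
      case 2
      then obtain A B where "\<phi> = (A + B \<Rrightarrow> B)"
        unfolding by_Ax_def by blast
      then show ?thesis using satisfies_Ax[OF e] by simp
    next
      case 3
      then obtain A B C D where
        "\<psi> = (A \<Rrightarrow> B)" "\<chi> = (B + C \<Rrightarrow> D)" "\<phi> = (A + C \<Rrightarrow> D)"
        unfolding by_Cut_def by blast
      then show ?thesis using satisfies_Cut[OF e] IH 3 by blast
    qed
    then show ?case using IH by simp
  qed
  then show ?thesis
    using assms(2) unfolding provable_def by (metis last_in_set)
qed

end

lemma provable_imp_entails_over:
  assumes "\<Gamma> \<turnstile> \<phi>"
  shows "entails_over T \<Gamma> \<phi>"
  unfolding entails_over_def
proof (intro allI impI)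
  fix L :: "'b reslat" and e
  assume "complete_residuated_lattice L" and model: "is_model L e \<Gamma>"
  then interpret complete_residuated_lattice L by blast
  show "satisfies L e \<phi>"
    using model assms by (rule soundness)
qed

section \<open>The residuated lattice of down-sets\<close>

text \<open>The preorder puts \<open>X\<close> below \<open>Y\<close> when \<open>Y\<close> is
  derivable from \<open>X\<close>. The empty set qualifies and becomes the bottom element.\<close>

definition down_closed :: "'v mfd set \<Rightarrow> 'v multiset set \<Rightarrow> bool" where
  "down_closed \<Gamma> S \<longleftrightarrow> (\<forall>X Y. Y \<in> S \<longrightarrow> \<Gamma> \<turnstile> (X \<Rrightarrow> Y) \<longrightarrow> X \<in> S)"

definition down :: "'v mfd set \<Rightarrow> 'v multiset \<Rightarrow> 'v multiset set" where
  "down \<Gamma> A = {X. \<Gamma> \<turnstile> (X \<Rrightarrow> A)}"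

text \<open>The set of sums \<open>Y + Z\<close> need not be down-closed, so its down-closure is
  taken.\<close>

definition down_mult :: "'v mfd set \<Rightarrow> 'v multiset set \<Rightarrow> 'v multiset set \<Rightarrow> 'v multiset set" where
  "down_mult \<Gamma> S T = {X. \<exists>Y\<in>S. \<exists>Z\<in>T. \<Gamma> \<turnstile> (X \<Rrightarrow> Y + Z)}"

definition downset_lattice :: "'v mfd set \<Rightarrow> 'v multiset set reslat" where
  "downset_lattice \<Gamma> =
    \<lparr>carrier = {S. down_closed \<Gamma> S}, mult = down_mult \<Gamma>, one = UNIV,
     rmeet = (\<inter>), rjoin = (\<union>), rimp = (\<lambda>S T. {X. \<forall>Y\<in>S. X + Y \<in> T}), rzero = {}\<rparr>"

lemma downset_lattice_simps [simp]:
  "carrier (downset_lattice \<Gamma>) = {S. down_closed \<Gamma> S}"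
  "mult (downset_lattice \<Gamma>) = down_mult \<Gamma>"
  "one (downset_lattice \<Gamma>) = UNIV"
  "rmeet (downset_lattice \<Gamma>) = (\<inter>)"
  "rjoin (downset_lattice \<Gamma>) = (\<union>)"
  "rimp (downset_lattice \<Gamma>) = (\<lambda>S T. {X. \<forall>Y\<in>S. X + Y \<in> T})"
  "rzero (downset_lattice \<Gamma>) = {}"
  by (simp_all add: downset_lattice_def)

lemma rorder_downset_lattice [simp]:
  "carrier (rorder (downset_lattice \<Gamma>)) = {S. down_closed \<Gamma> S}"
  "(.=\<^bsub>rorder (downset_lattice \<Gamma>)\<^esub>) = (=)"
  "rle (downset_lattice \<Gamma>) S T \<longleftrightarrow> S \<subseteq> T"
  by (auto simp: rorder_def)

lemma down_closedD: "down_closed \<Gamma> S \<Longrightarrow> Y \<in> S \<Longrightarrow> \<Gamma> \<turnstile> (X \<Rrightarrow> Y) \<Longrightarrow> X \<in> S"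
  by (auto simp: down_closed_def)

lemma down_closed_down: "down_closed \<Gamma> (down \<Gamma> A)"
  unfolding down_closed_def down_def using provable_trans by blast

lemma down_closed_mult: "down_closed \<Gamma> (down_mult \<Gamma> S T)"
  unfolding down_closed_def down_mult_def using provable_trans by blast

text \<open>If \<open>X\<close> derives \<open>Y\<close>, then \<open>X + Z\<close> derives
  \<open>Y + Z\<close>, and down-closedness of \<open>T\<close> transfers membership.\<close>

lemma down_closed_imp:
  assumes "down_closed \<Gamma> T"
  shows "down_closed \<Gamma> {X. \<forall>Y\<in>S. X + Y \<in> T}"
proof -
  have "X + Z \<in> T" if "\<forall>Z\<in>S. Y + Z \<in> T" "\<Gamma> \<turnstile> (X \<Rrightarrow> Y)" "Z \<in> S" for X Y Z
    using down_closedD[OF assms _ provable_add[OF that(2) provable_refl]] that(1,3) by blast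
  then show ?thesis
    unfolding down_closed_def by blast
qed

section \<open>Algebra of the down-set product\<close>

lemma down_mult_commute: "down_mult \<Gamma> S T = down_mult \<Gamma> T S"
proof -
  have "down_mult \<Gamma> S T \<subseteq> down_mult \<Gamma> T S" for S T
  proof
    fix X assume "X \<in> down_mult \<Gamma> S T"
    then obtain Y Z where "Y \<in> S" "Z \<in> T" "\<Gamma> \<turnstile> (X \<Rrightarrow> Z + Y)"
      unfolding down_mult_def by (auto simp: add.commute)
    then show "X \<in> down_mult \<Gamma> T S"
      unfolding down_mult_def by blast
  qed
  then show ?thesis by blast
qed

lemma down_mult_assoc_subset:
  "down_mult \<Gamma> (down_mult \<Gamma> S T) U \<subseteq> down_mult \<Gamma> S (down_mult \<Gamma> T U)"
proof
  fix X assume "X \<in> down_mult \<Gamma> (down_mult \<Gamma> S T) U"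
  then obtain W Y Z V where "\<Gamma> \<turnstile> (X \<Rrightarrow> W + V)" "\<Gamma> \<turnstile> (W \<Rrightarrow> Y + Z)" "Y \<in> S" "Z \<in> T" "V \<in> U"
    unfolding down_mult_def by blast
  moreover from this have "\<Gamma> \<turnstile> (X \<Rrightarrow> Y + (Z + V))"
    using provable_trans provable_add[OF _ provable_refl] unfolding add.assoc[symmetric] by blast
  ultimately show "X \<in> down_mult \<Gamma> S (down_mult \<Gamma> T U)"
    unfolding down_mult_def using provable_refl by blast
qed

text \<open>Commutativity turns the inclusion, read with \<open>S\<close> and \<open>U\<close>
  exchanged, into its converse.\<close>

lemma down_mult_assoc:
  "down_mult \<Gamma> (down_mult \<Gamma> S T) U = down_mult \<Gamma> S (down_mult \<Gamma> T U)"
  by (metis down_mult_assoc_subset down_mult_commute subset_antisym)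

text \<open>By Ax, \<open>Y + Z\<close> derives \<open>Z\<close>, so multiplying by
  \<open>UNIV\<close> adds nothing; the empty multiset in \<open>UNIV\<close> recovers all of
  \<open>S\<close>.\<close>

lemma down_mult_UNIV:
  assumes "down_closed \<Gamma> S"
  shows "down_mult \<Gamma> UNIV S = S"
proof -
  have "X \<in> S" if "Z \<in> S" "\<Gamma> \<turnstile> (X \<Rrightarrow> Y + Z)" for X Y Z
    using down_closedD[OF assms that(1) provable_trans[OF that(2) provable_Ax]] .
  moreover have "\<Gamma> \<turnstile> (X \<Rrightarrow> {#} + X)" for X
    by (simp add: provable_refl)
  ultimately show ?thesis
    unfolding down_mult_def by blast
qed

text \<open>With \<open>down_empty\<close>, this makes \<open>down\<close> a monoid homomorphism
  from multisets under sum.\<close>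

lemma down_mult_down: "down_mult \<Gamma> (down \<Gamma> A) (down \<Gamma> B) = down \<Gamma> (A + B)"
proof -
  have "\<Gamma> \<turnstile> (X \<Rrightarrow> A + B)"
    if "\<Gamma> \<turnstile> (X \<Rrightarrow> Y + Z)" "\<Gamma> \<turnstile> (Y \<Rrightarrow> A)" "\<Gamma> \<turnstile> (Z \<Rrightarrow> B)" for X Y Z
    using that(1) provable_add[OF that(2,3)] by (rule provable_trans)
  then show ?thesis
    unfolding down_mult_def down_def using provable_refl by blast
qed

lemma down_empty: "down \<Gamma> {#} = UNIV"
  unfolding down_def using provable_Ax[of \<Gamma> _ "{#}"] by simp

lemma down_subset_iff: "down \<Gamma> A \<subseteq> down \<Gamma> B \<longleftrightarrow> \<Gamma> \<turnstile> (A \<Rrightarrow> B)"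
  unfolding down_def using provable_refl provable_trans by blast

text \<open>Both sides say that all sums of an element of \<open>S\<close> and one of
  \<open>T\<close> lie in \<open>U\<close>; down-closedness of \<open>U\<close> absorbs the closure
  built into the product.\<close>

lemma down_mult_adjoint:
  assumes "down_closed \<Gamma> U"
  shows "down_mult \<Gamma> S T \<subseteq> U \<longleftrightarrow> S \<subseteq> {X. \<forall>Y\<in>T. X + Y \<in> U}"
  unfolding down_mult_def using provable_refl down_closedD[OF assms] by blast

section \<open>Down-sets form a complete residuated lattice\<close>

lemma comm_monoid_downset_lattice: "comm_monoid (downset_lattice \<Gamma>)"
  by (rule comm_monoidI)
     (simp_all add: down_closed_mult down_mult_assoc down_mult_UNIV down_closed_def[of _ UNIV], rule down_mult_commute)

text \<open>Down-sets are closed under arbitrary unions and intersections; the empty family yields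
  the bounds \<open>{}\<close> and \<open>UNIV\<close>.\<close>

lemma complete_lattice_downset_lattice: "complete_lattice (rorder (downset_lattice \<Gamma>))"
proof -
  interpret partial_order "rorder (downset_lattice \<Gamma>)"
    by unfold_locales auto
  show ?thesis
  proof
    fix \<S> assume \<S>: "\<S> \<subseteq> carrier (rorder (downset_lattice \<Gamma>))"
    have "least (rorder (downset_lattice \<Gamma>)) (\<Union>\<S>) (Upper (rorder (downset_lattice \<Gamma>)) \<S>)"
      using \<S> by (fastforce simp: least_def Upper_def down_closed_def)
    then show "\<exists>s. least (rorder (downset_lattice \<Gamma>)) s (Upper (rorder (downset_lattice \<Gamma>)) \<S>)" ..
    have "greatest (rorder (downset_lattice \<Gamma>)) (\<Inter>\<S>) (Lower (rorder (downset_lattice \<Gamma>)) \<S>)"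
      using \<S> by (fastforce simp: greatest_def Lower_def down_closed_def)
    then show "\<exists>s. greatest (rorder (downset_lattice \<Gamma>)) s (Lower (rorder (downset_lattice \<Gamma>)) \<S>)" ..
  qed
qed

lemma complete_residuated_lattice_downset_lattice:
  "complete_residuated_lattice (downset_lattice \<Gamma>)"
proof -
  let ?L = "downset_lattice \<Gamma>"
  interpret comm_monoid ?L by (rule comm_monoid_downset_lattice)
  interpret order: complete_lattice "rorder ?L" by (rule complete_lattice_downset_lattice)
  show ?thesis
  proof unfold_locales
    show "greatest (rorder ?L) (rmeet ?L S T) (Lower (rorder ?L) {S, T})"
      if "S \<in> carrier ?L" "T \<in> carrier ?L" for S T
      using that by (auto simp: greatest_def Lower_def down_closed_def)
    show "least (rorder ?L) (rjoin ?L S T) (Upper (rorder ?L) {S, T})"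
      if "S \<in> carrier ?L" "T \<in> carrier ?L" for S T
      using that by (auto simp: least_def Upper_def down_closed_def)
    show "least (rorder ?L) (rzero ?L) (carrier ?L)"
      by (auto simp: least_def down_closed_def)
    show "greatest (rorder ?L) \<one>\<^bsub>?L\<^esub> (carrier ?L)"
      by (auto simp: greatest_def down_closed_def)
    show "rle ?L (S \<otimes>\<^bsub>?L\<^esub> U) (T \<otimes>\<^bsub>?L\<^esub> V)" if "rle ?L S T" "rle ?L U V" for S T U V
      using that by (auto simp: down_mult_def)
  qed (auto simp: down_closed_imp down_mult_adjoint)
qed

section \<open>The canonical evaluation\<close>

lemma evaluation_down: "evaluation (downset_lattice \<Gamma>) (\<lambda>p. down \<Gamma> {#p#})"
  by (auto simp: evaluation_def down_closed_down)

lemma eval_mset_down: "eval_mset (downset_lattice \<Gamma>) (\<lambda>p. down \<Gamma> {#p#}) A = down \<Gamma> A"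
proof -
  interpret complete_residuated_lattice "downset_lattice \<Gamma>"
    by (rule complete_residuated_lattice_downset_lattice)
  show ?thesis
  proof (induction A)
    case empty
    then show ?case by (simp add: eval_mset_empty down_empty)
  next
    case (add p A)
    then show ?case
      \<comment> \<open>Adding one copy of \<open>p\<close> is read as the sum
        \<open>{#p#} + A\<close>, to which the homomorphism property applies.\<close>
      using eval_mset_union[OF evaluation_down, where A = "{#p#}" and B = A]
      by (simp add: eval_mset_single[OF evaluation_down] down_mult_down)
  qed
qed

text \<open>Satisfaction is inclusion of principal down-sets, which amounts to derivability by
  reflexivity and transitivity.\<close>

lemma satisfies_down_iff:
  "satisfies (downset_lattice \<Gamma>) (\<lambda>p. down \<Gamma> {#p#}) \<phi> \<longleftrightarrow> \<Gamma> \<turnstile> \<phi>"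
  by (cases \<phi>) (simp add: eval_mset_down down_subset_iff)

theorem theorem5:
  fixes \<Gamma> :: "'v :: {countable, infinite} mfd set"
    and A B :: "'v multiset"
  shows "\<Gamma> \<turnstile> (A \<Rrightarrow> B) \<longleftrightarrow>
    entails_over TYPE('l) \<Gamma> (A \<Rrightarrow> B) \<and>
    entails_over TYPE('v multiset set) \<Gamma> (A \<Rrightarrow> B)"
proof
  assume "\<Gamma> \<turnstile> (A \<Rrightarrow> B)"
  then show "entails_over TYPE('l) \<Gamma> (A \<Rrightarrow> B) \<and>
    entails_over TYPE('v multiset set) \<Gamma> (A \<Rrightarrow> B)"
    by (intro conjI provable_imp_entails_over)
next
  let ?L = "downset_lattice \<Gamma>" and ?e = "\<lambda>p. down \<Gamma> {#p#}"
  assume "entails_over TYPE('l) \<Gamma> (A \<Rrightarrow> B) \<and>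
    entails_over TYPE('v multiset set) \<Gamma> (A \<Rrightarrow> B)"
  \<comment> \<open>Each member of \<open>\<Gamma>\<close> is provable by a one-line proof, hence
    satisfied.\<close>
  moreover have "is_model ?L ?e \<Gamma>"
    by (simp add: is_model_def evaluation_down satisfies_down_iff provable_hyp)
  ultimately have "satisfies ?L ?e (A \<Rrightarrow> B)"
    using complete_residuated_lattice_downset_lattice unfolding entails_over_def by blast
  then show "\<Gamma> \<turnstile> (A \<Rrightarrow> B)"
    by (simp only: satisfies_down_iff)
qed

end
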